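(* Let $\Omega\subset\mathbb{R}^N$ be a domain, let $p\ge 1$ and $\alpha\ge 0$. Then $V^{p\infty,\alpha}(\Omega)=M^{p,\alpha}(\Omega)$.
   Context: Notation: $p'$ is the conjugate exponent, $1/p+1/p'=1$; $B_R(x_0)$ is the ball of radius $R$ centered at $x_0$. Fix $R_0<1/2$. $\mathcal{B}(\Omega)$ is the set of all collections $\{B_j\}$ of mutually disjoint balls $B_j=B_{R_j}(x_j)\subset\Omega$ with radii $R_j\le R_0$. For such a collection put $\bar f_j:=\frac{1}{|B_j|}\int_{B_j}|f(x)|\,dx$. For $1\le p\le q\le\infty$ and $\alpha\ge 0$, $V^{pq,\alpha}(\Omega)=V^{pq}(\log V)^\alpha(\Omega)$ is the space of all $f\in L^1(\Omega)$ with $$\|f\|_{V^{pq,\alpha}(\Omega)}:=\sup_{\{B_j\}\in\mathcal{B}(\Omega)}\big\|\{R_j^{N/p}|\log R_j|^\alpha\,\bar f_j\}_j\big\|_{\ell^q}<\infty .$$ The (logarithmically refined) Morrey space $M^{p,\alpha}(\Omega)$ is the space of all $f\in L^1(\Omega)$ for which there is a constant $C$ with $$\int_{B_R(x_0)}|f(x)|\,dx\le C\,R^{N/p'}|\log R|^{-\alpha}\quad\text{for all balls }B_R(x_0)\subset\Omega,\ R\le R_0<1 .$$ *)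

theory Defs
  imports "HOL-Analysis.Analysis"
begin

text \<open>
  Exponents \<open>p, q \<in> [1, \<infinity>]\<close> have type \<^typ>\<open>ennreal\<close>, where \<open>1 / \<infinity> = 0\<close> and \<open>1 / 0 = \<infinity>\<close>.
  Elements of \<open>L\<^sup>1(\<Omega>)\<close> are represented by Lebesgue integrable functions defined on the whole
  space, whose values outside \<open>\<Omega>\<close> are irrelevant; no quotient by a.e. equality is taken.
\<close>

definition conj_exponent :: "ennreal \<Rightarrow> ennreal" where
  "conj_exponent p = 1 / (1 - 1 / p)"

lemma conj_exponent_iff:
  assumes "1 \<le> p"
  shows "1 / p + 1 / p' = 1 \<longleftrightarrow> p' = conj_exponent p"
proof -
  have le: "1 / p \<le> 1"
    using assms
    by (cases p)
      (auto simp: divide_ennreal ennreal_le_1 simp flip: ennreal_1)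
  have "1 / p + 1 / p' = 1 \<longleftrightarrow> 1 / p' = 1 - 1 / p"
  proof
    assume "1 / p + 1 / p' = 1"
    moreover have "1 / p \<noteq> \<infinity>"
      using le by (auto simp: top_unique)
    ultimately show "1 / p' = 1 - 1 / p"
      by (metis ennreal_add_diff_cancel_left infinity_ennreal_def)
  next
    assume "1 / p' = 1 - 1 / p"
    then show "1 / p + 1 / p' = 1"
      using le by (simp add: add_diff_inverse_ennreal)
  qed
  also have "\<dots> \<longleftrightarrow> p' = conj_exponent p"
    unfolding conj_exponent_def by (metis one_divide_one_divide_ennreal)
  finally show ?thesis .
qed

text \<open>
  A ball \<open>B\<^bsub>R\<^esub>(x)\<close> is encoded as the pair \<open>(x, R)\<close>; for \<open>R > 0\<close> the open ball determines the
  pair. Collections may be empty or infinite (disjointness makes them countable).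
\<close>

definition ball_collections :: "real \<Rightarrow> 'a::euclidean_space set \<Rightarrow> ('a \<times> real) set set" where
  "ball_collections R0 \<Omega> =
     {\<B>. (\<forall>(x, R)\<in>\<B>. 0 < R \<and> R \<le> R0 \<and> ball x R \<subseteq> \<Omega>) \<and>
          disjoint_family_on (\<lambda>(x, R). ball x R) \<B>}"

definition ball_mean :: "('a::euclidean_space \<Rightarrow> real) \<Rightarrow> 'a \<Rightarrow> real \<Rightarrow> real" where
  "ball_mean f x R =
     1 / measure lebesgue (ball x R) * (LINT y:ball x R|lebesgue. \<bar>f y\<bar>)"

definition lq_norm :: "ennreal \<Rightarrow> 'i set \<Rightarrow> ('i \<Rightarrow> real) \<Rightarrow> ennreal" where
  "lq_norm q I a =
     (if q = \<infinity> then (SUP i\<in>I. ennreal \<bar>a i\<bar>)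
      else (let s = (\<Sum>\<^sub>\<infinity>i\<in>I. ennreal (\<bar>a i\<bar> powr enn2real q))
            in if s = \<infinity> then \<infinity> else ennreal (enn2real s powr (1 / enn2real q))))"

definition V_norm ::
    "real \<Rightarrow> ennreal \<Rightarrow> ennreal \<Rightarrow> real \<Rightarrow> 'a::euclidean_space set \<Rightarrow> ('a \<Rightarrow> real) \<Rightarrow> ennreal" where
  "V_norm R0 p q \<alpha> \<Omega> f =
     (SUP \<B>\<in>ball_collections R0 \<Omega>.
        lq_norm q \<B> (\<lambda>(x, R).
          R powr enn2real (of_nat DIM('a) / p) * \<bar>ln R\<bar> powr \<alpha> * ball_mean f x R))"

definition V_space ::
    "real \<Rightarrow> ennreal \<Rightarrow> ennreal \<Rightarrow> real \<Rightarrow> 'a::euclidean_space set \<Rightarrow> ('a \<Rightarrow> real) set" where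
  "V_space R0 p q \<alpha> \<Omega> =
     {f. f absolutely_integrable_on \<Omega> \<and> V_norm R0 p q \<alpha> \<Omega> f < \<infinity>}"

definition Morrey_space ::
    "real \<Rightarrow> ennreal \<Rightarrow> real \<Rightarrow> 'a::euclidean_space set \<Rightarrow> ('a \<Rightarrow> real) set" where
  "Morrey_space R0 p \<alpha> \<Omega> =
     {f. f absolutely_integrable_on \<Omega> \<and>
         (\<exists>C::real. \<forall>x R. 0 < R \<longrightarrow> R \<le> R0 \<longrightarrow> ball x R \<subseteq> \<Omega> \<longrightarrow>
            (LINT y:ball x R|lebesgue. \<bar>f y\<bar>)
              \<le> C * R powr enn2real (of_nat DIM('a) / conj_exponent p) * \<bar>ln R\<bar> powr (- \<alpha>))}"

end

theory Submission
  imports Defs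
begin

text \<open>For \<open>q = \<infinity>\<close> the outer norm is a supremum over the balls of a
  collection, so disjointness has no effect: every admissible ball forms a collection by itself, and
  the \<open>V_norm\<close> is the supremum over all single balls (\<open>V_norm_infinity\<close>).
  Finiteness thus means one bound K for all terms. Since the volume of a ball is c R^N and N/p +
  N/p' = N, dividing by the volume turns the weight R^(N/p) into R^(-N/p') / c, so the bound K on a
  term is exactly the Morrey inequality with C = K c (\<open>ball_mean_le_iff\<close>).\<close>

lemma enn2real_exponent_add:
  assumes "1 \<le> p"
  shows "enn2real (of_nat n / p) + enn2real (of_nat n / conj_exponent p) = real n"
proof -
  have "1 / p + 1 / conj_exponent p = 1"
    using conj_exponent_iff[OF assms] by blast
  then have "of_nat n * (1 / p + 1 / conj_exponent p) = (of_nat n :: ennreal)"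
    by simp
  then have sum: "of_nat n / p + of_nat n / conj_exponent p = (of_nat n :: ennreal)"
    by (simp add: distrib_left ennreal_times_divide)
  \<comment> \<open>\<open>enn2real\<close> sends \<open>top\<close> to 0, so it is additive only
    once both summands are known to be finite.\<close>
  then have "of_nat n / p < (top :: ennreal)" "of_nat n / conj_exponent p < (top :: ennreal)"
    by (metis ennreal_add_eq_top ennreal_of_nat_neq_top less_top)+
  then show ?thesis
    using sum by (metis enn2real_plus enn2real_of_nat)
qed

text \<open>Splitting the volume as c R^a R^b cancels the factor R^a. The bound \<open>R < 1\<close>
  makes \<open>ln R\<close> nonzero, so the logarithmic weight is positive and can be moved across
  the inequality.\<close>

lemma ball_mean_le_iff:
  fixes x :: "'a::euclidean_space"
  assumes "0 < R" "R < 1" "a + b = real DIM('a)"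
  shows "R powr a * \<bar>ln R\<bar> powr \<alpha> * ball_mean f x R \<le> K \<longleftrightarrow>
    (LINT y:ball x R|lebesgue. \<bar>f y\<bar>)
      \<le> K * unit_ball_vol (real DIM('a)) * R powr b * \<bar>ln R\<bar> powr (- \<alpha>)"
proof -
  let ?c = "unit_ball_vol (real DIM('a))" and ?I = "LINT y:ball x R|lebesgue. \<bar>f y\<bar>"
  have pos: "0 < ?c" "0 < R powr a" "0 < R powr b" "0 < \<bar>ln R\<bar> powr \<alpha>"
    using assms by auto
  have "R ^ DIM('a) = R powr a * R powr b"
    using assms by (simp flip: powr_add powr_realpow)
  then have vol: "measure lebesgue (ball x R) = ?c * (R powr a * R powr b)"
    using assms by (simp add: content_ball)
  show ?thesis
    unfolding ball_mean_def vol using pos by (simp add: powr_minus field_simps)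
qed

lemma ball_mean_nonneg: "0 \<le> ball_mean f x R"
  by (auto simp: ball_mean_def set_lebesgue_integral_def intro!: Bochner_Integration.integral_nonneg)

text \<open>Each term of a collection comes from an admissible ball, and each admissible ball gives
  a singleton collection, which is trivially disjoint.\<close>

lemma V_norm_infinity:
  "V_norm R0 p \<infinity> \<alpha> \<Omega> (f :: 'a::euclidean_space \<Rightarrow> real) =
    (SUP (x, R)\<in>{(x, R). 0 < R \<and> R \<le> R0 \<and> ball x R \<subseteq> \<Omega>}.
      ennreal (R powr enn2real (of_nat DIM('a) / p) * \<bar>ln R\<bar> powr \<alpha> * ball_mean f x R))"
  (is "_ = (SUP (x, R)\<in>?A. ennreal (?T x R))")
proof (rule antisym)
  have nonneg: "\<bar>?T x R\<bar> = ?T x R" for x R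
    by (simp add: ball_mean_nonneg)
  show "V_norm R0 p \<infinity> \<alpha> \<Omega> f \<le> (SUP (x, R)\<in>?A. ennreal (?T x R))"
    unfolding V_norm_def lq_norm_def
    by (force simp: ball_collections_def nonneg intro!: SUP_least intro: SUP_upper2)
  show "(SUP (x, R)\<in>?A. ennreal (?T x R)) \<le> V_norm R0 p \<infinity> \<alpha> \<Omega> f"
  proof (rule SUP_least)
    fix B assume "B \<in> ?A"
    then have "{B} \<in> ball_collections R0 \<Omega>"
      by (auto simp: ball_collections_def disjoint_family_on_def)
    then show "(case B of (x, R) \<Rightarrow> ennreal (?T x R)) \<le> V_norm R0 p \<infinity> \<alpha> \<Omega> f"
      unfolding V_norm_def lq_norm_def
      by (rule SUP_upper2) (simp add: nonneg split: prod.split)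
  qed
qed

text \<open>Passes from finiteness in \<open>ennreal\<close> to a real bound; nonnegativity matters
  because \<open>ennreal\<close> truncates negative values to 0.\<close>

lemma SUP_ennreal_less_top_iff:
  assumes "\<And>i. i \<in> I \<Longrightarrow> 0 \<le> g i"
  shows "(SUP i\<in>I. ennreal (g i)) < \<infinity> \<longleftrightarrow> (\<exists>K. \<forall>i\<in>I. g i \<le> K)"
proof
  assume *: "(SUP i\<in>I. ennreal (g i)) < \<infinity>"
  have "g i \<le> enn2real (SUP i\<in>I. ennreal (g i))" if "i \<in> I" for i
    using enn2real_mono[OF SUP_upper[OF that, of "\<lambda>i. ennreal (g i)"]] * assms that by simp
  then show "\<exists>K. \<forall>i\<in>I. g i \<le> K"
    by blast
next
  assume "\<exists>K. \<forall>i\<in>I. g i \<le> K"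
  then obtain K where "\<forall>i\<in>I. g i \<le> K"
    by blast
  then have "(SUP i\<in>I. ennreal (g i)) \<le> ennreal K"
    by (intro SUP_least ennreal_leI) simp
  then show "(SUP i\<in>I. ennreal (g i)) < \<infinity>"
    using le_less_trans by fastforce
qed

theorem lemma2p1:
  fixes \<Omega> :: "'a::euclidean_space set" and p :: ennreal and \<alpha> R0 :: real
  assumes "0 < R0" "R0 < 1 / 2"
    and "open \<Omega>" "connected \<Omega>" "\<Omega> \<noteq> {}"
    and "1 \<le> p" "0 \<le> \<alpha>"
  shows "V_space R0 p \<infinity> \<alpha> \<Omega> = Morrey_space R0 p \<alpha> \<Omega>"
proof -
  let ?A = "{(x, R). 0 < R \<and> R \<le> R0 \<and> ball x R \<subseteq> \<Omega>}"
  let ?a = "enn2real (of_nat DIM('a) / p)" and ?b = "enn2real (of_nat DIM('a) / conj_exponent p)"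
  let ?c = "unit_ball_vol (real DIM('a))"
  have "V_norm R0 p \<infinity> \<alpha> \<Omega> f < \<infinity> \<longleftrightarrow>
      (\<exists>C. \<forall>x R. 0 < R \<longrightarrow> R \<le> R0 \<longrightarrow> ball x R \<subseteq> \<Omega> \<longrightarrow>
        (LINT y:ball x R|lebesgue. \<bar>f y\<bar>) \<le> C * R powr ?b * \<bar>ln R\<bar> powr (- \<alpha>))"
    (is "_ \<longleftrightarrow> (\<exists>C. ?M C)") for f :: "'a \<Rightarrow> real"
  proof -
    have "V_norm R0 p \<infinity> \<alpha> \<Omega> f < \<infinity> \<longleftrightarrow>
        (\<exists>K. \<forall>(x, R)\<in>?A. R powr ?a * \<bar>ln R\<bar> powr \<alpha> * ball_mean f x R \<le> K)"
      unfolding V_norm_infinity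
      using SUP_ennreal_less_top_iff[of ?A
          "\<lambda>(x, R). R powr ?a * \<bar>ln R\<bar> powr \<alpha> * ball_mean f x R"]
      by (simp add: case_prod_beta' ball_mean_nonneg)
    \<comment> \<open>The equivalence holds ball by ball with the same K, as
      \<open>R \<le> R0 < 1 / 2\<close>.\<close>
    also have "\<dots> \<longleftrightarrow> (\<exists>K. ?M (K * ?c))"
    proof -
      have "R powr ?a * \<bar>ln R\<bar> powr \<alpha> * ball_mean f x R \<le> K \<longleftrightarrow>
          (LINT y:ball x R|lebesgue. \<bar>f y\<bar>) \<le> K * ?c * R powr ?b * \<bar>ln R\<bar> powr (- \<alpha>)"
        if "0 < R" "R \<le> R0" for x R K
        using that assms(2) enn2real_exponent_add[OF \<open>1 \<le> p\<close>] by (intro ball_mean_le_iff) auto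
      then show ?thesis
        by (intro ex_cong1) blast
    qed
    also have "\<dots> \<longleftrightarrow> (\<exists>C. ?M C)"
    proof
      assume "\<exists>C. ?M C"
      then obtain C where "?M C"
        by blast
      moreover have "?c \<noteq> 0"
        by (metis less_irrefl of_nat_0_le_iff unit_ball_vol_pos)
      \<comment> \<open>Rescaling by the positive volume \<open>?c\<close> of the unit ball reaches
        every constant C.\<close>
      ultimately have "?M (C / ?c * ?c)"
        by simp
      then show "\<exists>K. ?M (K * ?c)" ..
    qed blast
    finally show ?thesis .
  qed
  then show ?thesis
    unfolding V_space_def Morrey_space_def by simp
qed

end
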